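(* For all positive integers $k,n$, it holds that $$s^{(m)}_{k,n}=2s_{k,n}-s_{k,n+1}.$$
   Context: A finite nonempty set $F\subset\mathbb{N}$ is called Schreier if $\min F\ge|F|$ and maximal Schreier if $\min F=|F|$. For $k,n\in\mathbb{N}$, let $s_{k,n}$ be the number of sets $F\subset\{k,2k,\ldots,nk\}$ such that $F$ is Schreier and $nk\in F$, and let $s^{(m)}_{k,n}$ be the number of sets $F\subset\{k,2k,\ldots,nk\}$ such that $F$ is maximal Schreier and $nk\in F$. *)

theory Defs
  imports Main
begin

(* The ground set is {1, 2, 3, ...}, hence the condition that 0 is not in F. *)
definition schreier :: "nat set \<Rightarrow> bool" where
  "schreier F \<longleftrightarrow> finite F \<and> F \<noteq> {} \<and> 0 \<notin> F \<and> Min F \<ge> card F"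

definition maximal_schreier :: "nat set \<Rightarrow> bool" where
  "maximal_schreier F \<longleftrightarrow> finite F \<and> F \<noteq> {} \<and> 0 \<notin> F \<and> Min F = card F"

definition multiples_upto :: "nat \<Rightarrow> nat \<Rightarrow> nat set" where
  "multiples_upto k n = (\<lambda>i. i * k) ` {1..n}"

definition schreier_count :: "nat \<Rightarrow> nat \<Rightarrow> nat" where
  "schreier_count k n = card {F. F \<subseteq> multiples_upto k n \<and> schreier F \<and> n * k \<in> F}"

definition maximal_schreier_count :: "nat \<Rightarrow> nat \<Rightarrow> nat" where
  "maximal_schreier_count k n =
    card {F. F \<subseteq> multiples_upto k n \<and> maximal_schreier F \<and> n * k \<in> F}"

end

theory Submission
  imports Defs
begin

text \<open>A Schreier set \<open>F\<close> with maximum \<open>(n + 1) k\<close> either omits \<open>n k\<close>, and then replacing its maximum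
  by \<open>n k\<close> gives an arbitrary Schreier set with maximum \<open>n k\<close>; or it contains \<open>n k\<close>, and then
  deleting its maximum lowers the cardinality but not the minimum, giving an arbitrary Schreier set
  with maximum \<open>n k\<close> that is not maximal Schreier. Hence
  \<open>s\<^sub>k\<^sub>,\<^sub>n\<^sub>+\<^sub>1\<close> is the sum of \<open>s\<^sub>k\<^sub>,\<^sub>n\<close> and the difference of \<open>s\<^sub>k\<^sub>,\<^sub>n\<close> and the maximal count.\<close>

text \<open>A finite nonempty set has cardinality at least 1, so a bound by the cardinality on every
  element already rules out 0.\<close>

lemma schreier_iff:
  "schreier F \<longleftrightarrow> finite F \<and> F \<noteq> {} \<and> (\<forall>x\<in>F. card F \<le> x)"
  unfolding schreier_def by (metis Min_ge_iff card_gt_0_iff leD)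

lemma maximal_schreier_imp_schreier: "maximal_schreier F \<Longrightarrow> schreier F"
  unfolding schreier_def maximal_schreier_def by simp

text \<open>Failing to be maximal makes the inequality for the minimum strict. This slack of one is
  what permits adjoining one larger element.\<close>

lemma schreier_not_maximal_iff:
  "schreier F \<and> \<not> maximal_schreier F \<longleftrightarrow> finite F \<and> F \<noteq> {} \<and> (\<forall>x\<in>F. card F < x)"
proof -
  have "schreier F \<and> \<not> maximal_schreier F \<longleftrightarrow> finite F \<and> F \<noteq> {} \<and> 0 \<notin> F \<and> card F < Min F"
    unfolding schreier_def maximal_schreier_def by auto
  then show ?thesis by (metis Min_gr_iff not_less_zero)
qed

lemma finite_multiples_upto: "finite (multiples_upto k n)"
  unfolding multiples_upto_def by simp

lemma multiples_upto_Suc: "multiples_upto k (n + 1) = insert ((n + 1) * k) (multiples_upto k n)"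
  unfolding multiples_upto_def by (auto simp: atLeastAtMostSuc_conv)

lemma multiples_upto_le: "x \<in> multiples_upto k n \<Longrightarrow> x \<le> n * k"
  unfolding multiples_upto_def by auto

lemma multiple_in_multiples_upto: "n \<ge> 1 \<Longrightarrow> n * k \<in> multiples_upto k n"
  unfolding multiples_upto_def by auto

text \<open>Only the order matters here: \<open>a\<close> is the largest element of \<open>A\<close>
  and \<open>b\<close> lies above it. Exchanging them preserves the cardinality, and raising an
  element cannot violate the Schreier condition.\<close>

lemma bij_betw_schreier_replace:
  assumes "finite A" and le: "\<And>x. x \<in> A \<Longrightarrow> x \<le> a" and "a \<in> A" and "0 < a" and "a < b"
  shows "bij_betw (\<lambda>F. insert b (F - {a}))
    {F. F \<subseteq> A \<and> schreier F \<and> a \<in> F} {F. F \<subseteq> insert b A \<and> schreier F \<and> b \<in> F \<and> a \<notin> F}"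
    (is "bij_betw ?f ?S ?T")
proof (rule bij_betw_byWitness[where f' = "\<lambda>F. insert a (F - {b})"])
  have "b \<notin> A" using le \<open>a < b\<close> by fastforce
  then show "\<forall>F\<in>?S. insert a (?f F - {b}) = F" by auto
  show "\<forall>F\<in>?T. ?f (insert a (F - {b})) = F" by auto
  show "?f ` ?S \<subseteq> ?T"
  proof (intro image_subsetI)
    fix F assume F: "F \<in> ?S"
    then have fin: "finite F" and "b \<notin> F"
      using \<open>finite A\<close> \<open>b \<notin> A\<close> finite_subset by auto
    then have "card (?f F) = card F"
      using F fin card_Suc_Diff1 by fastforce
    then show "?f F \<in> ?T"
      using F fin \<open>a < b\<close> by (fastforce simp: schreier_iff)
  qed
  show "(\<lambda>F. insert a (F - {b})) ` ?T \<subseteq> ?S"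
  proof (intro image_subsetI)
    fix F assume F: "F \<in> ?T"
    then have fin: "finite F" using \<open>finite A\<close> finite_subset by auto
    then have card: "card (insert a (F - {b})) = card F"
      using F card.remove by fastforce
    \<comment> \<open>On the way back an element is lowered, so \<open>a\<close> itself must be
      checked. Any element of \<open>F\<close> other than \<open>b\<close> lies between
      \<open>card F\<close> and \<open>a\<close>; the singleton \<open>{b}\<close> is where
      \<open>0 < a\<close> enters.\<close>
    have "card F \<le> a"
    proof (cases "F = {b}")
      case True
      then show ?thesis using \<open>0 < a\<close> by simp
    next
      case False
      then obtain x where "x \<in> F" "x \<in> A" using F by blast
      then have "card F \<le> x" using F by (simp add: schreier_iff)
      also have "x \<le> a" using le \<open>x \<in> A\<close> .
      finally show ?thesis .
    qed
    then show "insert a (F - {b}) \<in> ?S"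
      using F fin card \<open>a \<in> A\<close> by (auto simp: schreier_iff)
  qed
qed

text \<open>Adjoining \<open>b\<close> raises the cardinality by one and so turns the strict bounds
  into weak ones; removing \<open>b\<close> reverses this.\<close>

lemma bij_betw_schreier_insert:
  assumes "finite A" and le: "\<And>x. x \<in> A \<Longrightarrow> x \<le> a" and "a < b"
  shows "bij_betw (insert b)
    {F. F \<subseteq> A \<and> (schreier F \<and> \<not> maximal_schreier F) \<and> a \<in> F}
    {F. F \<subseteq> insert b A \<and> schreier F \<and> b \<in> F \<and> a \<in> F}"
    (is "bij_betw _ ?S ?T")
proof (rule bij_betw_byWitness[where f' = "\<lambda>F. F - {b}"])
  have "b \<notin> A" using le \<open>a < b\<close> by fastforce
  then show "\<forall>F\<in>?S. insert b F - {b} = F" by auto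
  show "\<forall>F\<in>?T. insert b (F - {b}) = F" by auto
  show "insert b ` ?S \<subseteq> ?T"
  proof (intro image_subsetI)
    fix F assume F: "F \<in> ?S"
    then have fin: "finite F" and "b \<notin> F"
      using \<open>finite A\<close> \<open>b \<notin> A\<close> finite_subset by auto
    then have "card (insert b F) = Suc (card F)" by simp
    moreover have "\<forall>x\<in>F. card F < x" using F schreier_not_maximal_iff by blast
    \<comment> \<open>The new element meets its bound because \<open>card F < a < b\<close>.\<close>
    ultimately show "insert b F \<in> ?T"
      using F fin \<open>a < b\<close> by (fastforce simp: schreier_iff)
  qed
  show "(\<lambda>F. F - {b}) ` ?T \<subseteq> ?S"
  proof (intro image_subsetI)
    fix F assume F: "F \<in> ?T"
    then have fin: "finite F" using \<open>finite A\<close> finite_subset by auto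
    then have "card F = Suc (card (F - {b}))"
      using F card.remove by fastforce
    then have "\<forall>x\<in>F - {b}. card (F - {b}) < x"
      using F by (auto simp: schreier_iff)
    \<comment> \<open>This also keeps the set nonempty after the deletion.\<close>
    moreover have "a \<in> F - {b}" using F \<open>a < b\<close> by simp
    ultimately show "F - {b} \<in> ?S"
      using F fin unfolding schreier_not_maximal_iff by blast
  qed
qed

theorem theorem1p5:
  fixes k n :: nat
  assumes "k \<ge> 1" and "n \<ge> 1"
  shows "int (maximal_schreier_count k n) =
    2 * int (schreier_count k n) - int (schreier_count k (n + 1))"
proof -
  define A where "A = multiples_upto k n"
  define a where "a = n * k"
  define b where "b = (n + 1) * k"
  have A: "finite A" "\<And>x. x \<in> A \<Longrightarrow> x \<le> a" "a \<in> A"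
    unfolding A_def a_def
    using finite_multiples_upto multiples_upto_le multiple_in_multiples_upto[OF assms(2)] by auto
  have ab: "0 < a" "a < b"
    using assms unfolding a_def b_def by auto
  let ?S = "{F. F \<subseteq> A \<and> schreier F \<and> a \<in> F}"
  let ?M = "{F. F \<subseteq> A \<and> maximal_schreier F \<and> a \<in> F}"
  let ?N = "{F. F \<subseteq> A \<and> (schreier F \<and> \<not> maximal_schreier F) \<and> a \<in> F}"
  let ?T0 = "{F. F \<subseteq> insert b A \<and> schreier F \<and> b \<in> F \<and> a \<notin> F}"
  let ?T1 = "{F. F \<subseteq> insert b A \<and> schreier F \<and> b \<in> F \<and> a \<in> F}"
  have fin: "finite ?S" "finite ?M" "finite ?N" "finite ?T0" "finite ?T1"
    using A(1) by simp_all
  have "schreier_count k (n + 1) = card (?T0 \<union> ?T1)"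
    unfolding schreier_count_def multiples_upto_Suc A_def[symmetric] b_def[symmetric]
    by (rule arg_cong[where f = card]) auto
  also have "\<dots> = card ?T0 + card ?T1"
    using fin by (intro card_Un_disjoint) auto
  also have "card ?T0 = card ?S"
    using bij_betw_schreier_replace[OF A ab] by (simp add: bij_betw_same_card)
  also have "card ?T1 = card ?N"
    using bij_betw_schreier_insert[OF A(1,2) ab(2)] by (simp add: bij_betw_same_card)
  finally have "schreier_count k (n + 1) = card ?S + card ?N" .
  moreover have "card ?S = card ?M + card ?N"
  proof -
    have "?S = ?M \<union> ?N" using maximal_schreier_imp_schreier by auto
    also have "card \<dots> = card ?M + card ?N"
      using fin by (intro card_Un_disjoint) auto
    finally show ?thesis .
  qed
  moreover have "schreier_count k n = card ?S" "maximal_schreier_count k n = card ?M"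
    unfolding schreier_count_def maximal_schreier_count_def A_def a_def by simp_all
  \<comment> \<open>Eliminating \<open>card ?N\<close> from the two sums gives the identity.\<close>
  ultimately show ?thesis by simp
qed

end
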